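(* Let $n\ge 1$, let $\mathbf p=(p_1,\ldots,p_n),\ \mathbf q=(q_1,\ldots,q_n)\in(0,\frac12]^n$, and assume that $p_1q_1=\max_{i\in[n]}p_iq_i$. Put $I=\{i\in[n]:p_iq_i=p_1q_1\}$. If $\mathcal A,\mathcal B\subseteq 2^{[n]}$ are cross-intersecting, then $$\mu_{\mathbf p}(\mathcal A)\,\mu_{\mathbf q}(\mathcal B)\le p_1q_1 .$$ Moreover, equality is characterized as follows. (i) If $p_1q_1<\frac14$, then equality holds if and only if $\mathcal A=\mathcal B=\mathcal S_j$ for some $j\in I$. (ii) If $p_1q_1=\frac14$, then $I=\{i\in[n]:p_i=q_i=\frac12\}\ne\emptyset$, and equality holds if and only if there is an increasing family $\mathcal H\subseteq 2^I$ with $|\mathcal H|=2^{|I|-1}$ such that $$\mathcal A=\{A\subseteq[n]:A\cap I\in\mathcal H\}\quad\text{and}\quad \mathcal B=\{B\subseteq[n]:B\cap I\in\mathcal H^*\},$$ where $\mathcal H^*=\{T\subseteq I: T\cap H\ne\emptyset\text{ for every }H\in\mathcal H\}$.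
   Context: Here $[n]=\{1,\ldots,n\}$ and $2^{X}$ is the power set of $X$. Families $\mathcal A,\mathcal B\subseteq 2^{[n]}$ are cross-intersecting if $A\cap B\neq\emptyset$ for all $A\in\mathcal A$, $B\in\mathcal B$. For $\mathbf p=(p_1,\ldots,p_n)\in(0,1)^n$ and $\mathcal A\subseteq 2^{[n]}$, the $\mathbf p$-biased measure is $\mu_{\mathbf p}(\mathcal A)=\sum_{A\in\mathcal A}\prod_{i\in A}p_i\prod_{i\in[n]\setminus A}(1-p_i)$. The star at $j\in[n]$ is $\mathcal S_j=\{A\subseteq[n]:j\in A\}$. A family $\mathcal H\subseteq 2^X$ is increasing if $A\in\mathcal H$ and $A\subseteq B\subseteq X$ imply $B\in\mathcal H$. *)

theory Defs
  imports Complex_Main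
begin

text \<open>The ground set \<open>[n]\<close> is \<open>{1..n}\<close>, and a vector \<open>p\<close> indexed by \<open>[n]\<close> is a function
  \<open>nat \<Rightarrow> real\<close> of which only the values on \<open>{1..n}\<close> matter.\<close>

definition cross_intersecting :: "'a set set \<Rightarrow> 'a set set \<Rightarrow> bool" where
  "cross_intersecting \<A> \<B> \<longleftrightarrow> (\<forall>A\<in>\<A>. \<forall>B\<in>\<B>. A \<inter> B \<noteq> {})"

definition biased_measure :: "nat \<Rightarrow> (nat \<Rightarrow> real) \<Rightarrow> nat set set \<Rightarrow> real" where
  "biased_measure n p \<A> = (\<Sum>A\<in>\<A>. (\<Prod>i\<in>A. p i) * (\<Prod>i\<in>{1..n} - A. 1 - p i))"

definition star :: "nat \<Rightarrow> nat \<Rightarrow> nat set set" where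
  "star n j = {A. A \<subseteq> {1..n} \<and> j \<in> A}"

definition increasing_family :: "'a set \<Rightarrow> 'a set set \<Rightarrow> bool" where
  "increasing_family X \<H> \<longleftrightarrow>
     \<H> \<subseteq> Pow X \<and> (\<forall>A B. A \<in> \<H> \<and> A \<subseteq> B \<and> B \<subseteq> X \<longrightarrow> B \<in> \<H>)"

text \<open>The family written \<open>\<H>\<^sup>*\<close> in the literature, relative to the ground set \<open>X\<close>.\<close>

definition dual_family :: "'a set \<Rightarrow> 'a set set \<Rightarrow> 'a set set" where
  "dual_family X \<H> = {T. T \<subseteq> X \<and> (\<forall>H\<in>\<H>. T \<inter> H \<noteq> {})}"

end

theory Submission
  imports Defs
begin

text \<open>Put \<open>m = 2 p\<^sub>1 q\<^sub>1\<close>. The pair of measures \<open>(a, b)\<close> of two increasing cross-intersecting families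
  satisfies, besides \<open>2 a b \<le> m\<close>, the bound
  \<open>a b / ((1 - a) (1 - b)) \<le> m / (1 - m)\<close> on the product of the odds, here written as
  \<open>(1 - 2 m) a b + m (a + b) \<le> m\<close>. The conjunction of both is proved by induction on the ground set.
  Splitting along a coordinate replaces the families by sections of measures \<open>x \<le> y\<close> and
  \<open>v \<le> u\<close> such that the induction hypothesis applies to \<open>(x, u)\<close> and \<open>(y, v)\<close>. Both constraints are
  bilinear in \<open>(p\<^sub>i, q\<^sub>i)\<close> with nonnegative coefficients, so that the worst cases are
  \<open>(1/2, m)\<close> and \<open>(m, 1/2)\<close>, which leaves polynomial inequalities. For \<open>m < 1/2\<close> equality in a step
  forces equal sections or a star. For \<open>m = 1/2\<close> the odds bound reads \<open>a + b \<le> 1\<close>, and equality there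
  forces equal sections along every coordinate with \<open>p\<^sub>i + q\<^sub>i < 1\<close>.\<close>

section \<open>The inequalities for one coordinate\<close>

text \<open>Clearing denominators keeps the odds bound meaningful at \<open>a = 1\<close> or
  \<open>b = 1\<close>. The boundary curves of the two bounds meet at \<open>(1/2, m)\<close> and
  \<open>(m, 1/2)\<close>.\<close>

definition feasible :: "real \<Rightarrow> real \<Rightarrow> real \<Rightarrow> bool" where
  "feasible m a b \<longleftrightarrow> 0 \<le> a \<and> a \<le> 1 \<and> 0 \<le> b \<and> b \<le> 1 \<and>
     2 * a * b \<le> m \<and> (1 - 2 * m) * a * b + m * (a + b) \<le> m"

lemma feasible_commute: "feasible m a b \<longleftrightarrow> feasible m b a"
  by (auto simp: feasible_def algebra_simps)

text \<open>This is a coordinate with \<open>p = 1/2\<close> and \<open>q = m\<close>. The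
  hypotheses, solved for \<open>u\<close> and \<open>v\<close>, bound \<open>b\<close> by
  \<open>m\<close> times a weighted sum of \<open>(1 - x) / U\<close> and
  \<open>(1 - y) / V\<close>; the claim is \<open>b \<le> m * (1 - a) / c\<close> for the mean
  \<open>c\<close> of \<open>U\<close> and \<open>V\<close>. After clearing denominators the
  difference factors into nonnegative terms.\<close>

lemma odds_bound_halfstep:
  fixes m x y u v :: real
  assumes m: "0 < m" "m \<le> 1/2" and x: "0 \<le> x" "x \<le> y" "y \<le> 1"
    and xu: "(1 - 2 * m) * x * u + m * (x + u) \<le> m"
    and yv: "(1 - 2 * m) * y * v + m * (y + v) \<le> m"
  defines "a \<equiv> (x + y) / 2" and "b \<equiv> (1 - m) * v + m * u"
  shows "(1 - 2 * m) * a * b + m * (a + b) \<le> m"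
proof -
  define U V where "U = m + (1 - 2 * m) * x" and "V = m + (1 - 2 * m) * y"
  have U: "0 < U" and V: "0 < V"
    using m x by (auto simp: U_def V_def add_pos_nonneg)
  have uU: "u * U \<le> m * (1 - x)" and vV: "v * V \<le> m * (1 - y)"
    using xu yv by (simp_all add: U_def V_def algebra_simps)
  have "b * (U * V) = (1 - m) * U * (v * V) + m * V * (u * U)"
    by (simp add: b_def algebra_simps)
  also have "\<dots> \<le> (1 - m) * U * (m * (1 - y)) + m * V * (m * (1 - x))"
    using m U V by (intro add_mono mult_left_mono uU vV) auto
  finally have b: "b * (U * V) \<le> m * ((1 - m) * (1 - y) * U + m * (1 - x) * V)"
    by (simp add: algebra_simps)
  have "2 * (1 - a) * (U * V) - ((1 - m) * (1 - y) * U + m * (1 - x) * V) * (U + V)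
      = (1 - m) * (1 - 2 * m) * (y - x) * (m * (1 - y) + (1 - m) * x)"
    unfolding a_def U_def V_def by algebra
  also have "\<dots> \<ge> 0" using m x by (intro mult_nonneg_nonneg add_nonneg_nonneg) auto
  finally have "m * (((1 - m) * (1 - y) * U + m * (1 - x) * V) * (U + V)) \<le> m * (2 * (1 - a) * (U * V))"
    using m by (intro mult_left_mono) auto
  moreover have "b * (U * V) * (U + V) \<le> m * ((1 - m) * (1 - y) * U + m * (1 - x) * V) * (U + V)"
    using U V b by (intro mult_right_mono) auto
  ultimately have "(b * (U + V)) * (U * V) \<le> (m * (2 * (1 - a))) * (U * V)"
    by (simp add: algebra_simps)
  hence "b * (U + V) \<le> m * (2 * (1 - a))"
    by (rule mult_right_le_imp_le) (use U V in simp)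
  thus ?thesis by (simp add: a_def U_def V_def algebra_simps add_divide_distrib)
qed

text \<open>Solving the odds bound for \<open>b\<close> gives
  \<open>2 * a * b \<le> m * (2 * a * (1 - a)) / c\<close>, and \<open>c - 2 * a * (1 - a)\<close>
  factors as \<open>(m - a) * (1 - 2 * a)\<close>. So the odds bound is the stricter one outside the
  interval from \<open>m\<close> to \<open>1/2\<close>.\<close>

lemma odds_bound_imp_product_less:
  fixes m a b :: real
  assumes "0 < m" "m \<le> 1/2" "0 \<le> a" "a \<le> 1" and ab: "(1 - 2 * m) * a * b + m * (a + b) \<le> m"
    and out: "a < m \<or> 1/2 < a"
  shows "2 * a * b < m"
proof -
  define c where "c = m + (1 - 2 * m) * a"
  have c: "0 < c" using assms by (auto simp: c_def add_pos_nonneg)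
  have "0 < (m - a) * (1 - 2 * a)" using out assms(2)
    by (auto intro: mult_pos_pos mult_neg_neg)
  also have "(m - a) * (1 - 2 * a) = c - 2 * a * (1 - a)" by (simp add: c_def algebra_simps)
  finally have "m * (2 * a * (1 - a)) < m * c" using assms by simp
  moreover have "2 * a * (b * c) \<le> 2 * a * (m * (1 - a))"
    using ab assms by (intro mult_left_mono) (auto simp: c_def algebra_simps)
  ultimately have "(2 * a * b) * c < m * c" by (simp add: algebra_simps)
  thus ?thesis using c by simp
qed

text \<open>In the middle range \<open>m \<le> (x + y) / 2 \<le> 1/2\<close> both constraints on \<open>u\<close> and \<open>v\<close> are
  used: the product bound as long as \<open>m * y \<le> (1 - m) * x\<close>, otherwise the odds bound on \<open>u\<close>
  and, depending on whether \<open>y \<ge> 1/2\<close>, one of the two on \<open>v\<close>.\<close>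

lemma product_bound_halfstep:
  fixes m x y u v :: real
  assumes m: "0 < m" "m \<le> 1/2" and xy: "x \<le> y"
    and xu: "feasible m x u" and yv: "feasible m y v"
  defines "a \<equiv> (x + y) / 2" and "b \<equiv> (1 - m) * v + m * u"
  shows "2 * a * b \<le> m"
    and "m < 1/2 \<Longrightarrow> 2 * a * b = m \<Longrightarrow> x = y \<and> u = v \<or> x = 0 \<and> y = 1 \<and> v = 0 \<and> u = 1"
proof -
  \<comment> \<open>\<open>P\<close> collects the equality cases: equal sections, or the values of a
    star at this coordinate.\<close>
  define P where "P \<longleftrightarrow> x = y \<and> u = v \<or> x = 0 \<and> y = 1 \<and> v = 0 \<and> u = 1"
  have bd: "0 \<le> x" "x \<le> 1" "0 \<le> y" "y \<le> 1" "0 \<le> u" "u \<le> 1" "0 \<le> v" "v \<le> 1"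
    and pxu: "2 * x * u \<le> m" and pyv: "2 * y * v \<le> m"
    and hxu: "(1 - 2 * m) * x * u + m * (x + u) \<le> m"
    and hyv: "(1 - 2 * m) * y * v + m * (y + v) \<le> m"
    using xu yv by (auto simp: feasible_def)
  define U V where "U = m + (1 - 2 * m) * x" and "V = m + (1 - 2 * m) * y"
  have U: "0 < U" and V: "0 < V"
    using m bd by (auto simp: U_def V_def add_pos_nonneg)
  have uU: "u * U \<le> m * (1 - x)" and vV: "v * V \<le> m * (1 - y)"
    using hxu hyv by (simp_all add: U_def V_def algebra_simps)
  have "2 * a * b \<le> m \<and> (m < 1/2 \<longrightarrow> 2 * a * b = m \<longrightarrow> P)"
  proof (cases "a < m \<or> 1/2 < a")
    case True
    have "2 * a * b < m"
      using m bd xy True odds_bound_halfstep[OF m bd(1) xy bd(4) hxu hyv]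
      by (intro odds_bound_imp_product_less) (auto simp: a_def b_def)
    thus ?thesis by simp
  next
    case False
    hence a: "2 * m \<le> x + y" "x + y \<le> 1" by (auto simp: a_def)
    have y: "m \<le> y" using a xy by simp
    \<comment> \<open>If the first case fails and \<open>x \<ge> m\<close>, then
      \<open>y > 1 - m\<close>, against \<open>x + y \<le> 1\<close>.\<close>
    consider "m * y \<le> (1 - m) * x" | "x < m" "1/2 \<le> y" | "x < m" "y < 1/2"
    proof -
      have "x < m" if "(1 - m) * x < m * y"
      proof (rule ccontr)
        assume "\<not> x < m"
        hence "(1 - m) * m \<le> (1 - m) * x" using m by (intro mult_left_mono) auto
        hence "m * (1 - m) < m * y" using that by (simp add: mult.commute)
        hence "1 - m < y" using m by simp
        thus False using \<open>\<not> x < m\<close> a by simp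
      qed
      thus ?thesis using that by linarith
    qed
    thus ?thesis
    proof cases
      case 1
      have y0: "0 < y" using y m by simp
      have x0: "0 < x"
      proof (rule ccontr)
        assume "\<not> 0 < x"
        hence "m * y \<le> 0" using 1 bd by simp
        thus False using m y0 by (simp add: mult_le_0_iff)
      qed
      have xy0: "0 < x * y" using x0 y0 by simp
      \<comment> \<open>The factor \<open>2 * (x * y)\<close> makes both product bounds applicable
        without division. What remains is a defect
        \<open>m * ((y - x) * ((1 - m) * x - m * y))\<close>, nonnegative exactly because of the
        case condition when \<open>x < y\<close>.\<close>
      have 2: "(2 * a * b) * (2 * (x * y)) = (x + y) * ((1 - m) * x * (2 * y * v) + m * y * (2 * x * u))"
        unfolding a_def b_def by algebra
      have 3: "(1 - m) * x * (2 * y * v) + m * y * (2 * x * u) \<le> (1 - m) * x * m + m * y * m"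
        using m bd by (intro add_mono mult_left_mono pxu pyv) auto
      have 4: "(x + y) * ((1 - m) * x * m + m * y * m)
          = m * (2 * (x * y)) - m * ((y - x) * ((1 - m) * x - m * y))"
        by algebra
      have 5: "0 \<le> (y - x) * ((1 - m) * x - m * y)" using xy 1 by (intro mult_nonneg_nonneg) auto
      have 6: "(2 * a * b) * (2 * (x * y)) \<le> m * (2 * (x * y)) - m * ((y - x) * ((1 - m) * x - m * y))"
        unfolding 2 4[symmetric] using 3 bd by (intro mult_left_mono) auto
      also have "\<dots> \<le> m * (2 * (x * y))" using 5 m by simp
      finally have le: "2 * a * b \<le> m" by (rule mult_right_le_imp_le) (use xy0 in simp)
      moreover have P if m': "m < 1/2" and eq: "2 * a * b = m"
      proof -
        have "m * ((y - x) * ((1 - m) * x - m * y)) \<le> 0" using 6 unfolding eq by linarith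
        hence "m * ((y - x) * ((1 - m) * x - m * y)) \<le> m * 0" by (simp only: mult_zero_right)
        hence "(y - x) * ((1 - m) * x - m * y) \<le> 0"
          by (rule mult_left_le_imp_le) (rule m)
        hence "(y - x) * ((1 - m) * x - m * y) = 0" using 5 by (rule antisym)
        hence "x = y \<or> (1 - m) * x = m * y" using m by auto
        \<comment> \<open>This alternative is contradictory: it gives \<open>x \<le> m\<close> and
          makes both product bounds tight. Tightness forces \<open>m \<le> x\<close> and
          \<open>y \<le> 1/2\<close>, whereas \<open>x = m\<close> yields
          \<open>y = 1 - m > 1/2\<close>.\<close>
        moreover have "x = y" if r: "(1 - m) * x = m * y"
        proof (rule ccontr)
          assume "x \<noteq> y"
          have "m * (x + y) = x" using r by (simp add: algebra_simps)
          moreover have "m * (x + y) \<le> m * 1" using a m by (intro mult_left_mono) auto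
          ultimately have "x \<le> m" by simp
          have eq3: "(1 - m) * x * (2 * y * v) + m * y * (2 * x * u) = (1 - m) * x * m + m * y * m"
          proof (rule antisym[OF 3])
            have "(x + y) * ((1 - m) * x * m + m * y * m)
              = (x + y) * ((1 - m) * x * (2 * y * v) + m * y * (2 * x * u))"
              using 2 4 eq r by simp
            thus "(1 - m) * x * m + m * y * m \<le> (1 - m) * x * (2 * y * v) + m * y * (2 * x * u)"
              using x0 y0 by simp
          qed
          have le1: "(1 - m) * x * (2 * y * v) \<le> (1 - m) * x * m" "m * y * (2 * x * u) \<le> m * y * m"
            by (rule mult_left_mono, rule pyv, use m bd in simp, rule mult_left_mono, rule pxu, use m bd in simp)
          have "(1 - m) * x * (2 * y * v) = (1 - m) * x * m" "m * y * (2 * x * u) = m * y * m"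
            using eq3 le1 by linarith+
          hence e: "2 * y * v = m" "2 * x * u = m" using m' m x0 y0 by simp_all
          have "\<not> x < m" using odds_bound_imp_product_less[OF m bd(1,2) hxu] e by auto
          moreover have "\<not> 1/2 < y" using odds_bound_imp_product_less[OF m bd(3,4) hyv] e by auto
          ultimately have "x = m" using \<open>x \<le> m\<close> by simp
          hence "y = 1 - m" using r m by (simp add: mult.commute)
          thus False using \<open>\<not> 1/2 < y\<close> m' by simp
        qed
        ultimately have "x = y" by blast
        \<comment> \<open>Here \<open>m\<close> is the average of \<open>2 * x * v\<close> and
          \<open>2 * x * u\<close> with weights \<open>1 - m\<close> and \<open>m\<close>. Both are
          at most \<open>m\<close>, so both equal it.\<close>
        have "2 * x * ((1 - m) * v + m * u) = m" using eq \<open>x = y\<close> by (simp add: a_def b_def)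
        moreover have "(1 - m) * (2 * x * v) \<le> (1 - m) * m" "m * (2 * x * u) \<le> m * m"
          unfolding \<open>x = y\<close> using mult_left_mono[OF pyv, of "1 - m"] mult_left_mono[OF pxu, of m] m
          by (simp_all add: \<open>x = y\<close>)
        moreover have "2 * x * ((1 - m) * v + m * u) = (1 - m) * (2 * x * v) + m * (2 * x * u)"
          "m = (1 - m) * m + m * m"
          by (auto simp: algebra_simps)
        ultimately have "(1 - m) * (2 * x * v) = (1 - m) * m" "m * (2 * x * u) = m * m"
          by linarith+
        hence "2 * x * v = 2 * x * u" using m by auto
        thus P using \<open>x = y\<close> x0 by (simp add: P_def)
      qed
      ultimately show ?thesis by blast
    next
      case 2
      have b: "b * (U * V) \<le> m * ((1 - m) * (1 - y) * U + m * (1 - x) * V)"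
      proof -
        have "b * (U * V) = (1 - m) * U * (v * V) + m * V * (u * U)"
          by (simp add: b_def algebra_simps)
        also have "\<dots> \<le> (1 - m) * U * (m * (1 - y)) + m * V * (m * (1 - x))"
          using m U V by (intro add_mono mult_left_mono uU vV) auto
        finally show ?thesis by (simp add: algebra_simps)
      qed
      \<comment> \<open>\<open>B\<close> is the cofactor that remains in the slack of the odds
        estimate next to the square \<open>(1 - x - y)^2\<close>; see \<open>id\<close>.\<close>
      define B where "B = y * (y - m) - x * (1 - m - y)"
      have B: "0 \<le> B \<and> (m < 1/2 \<longrightarrow> 0 < B)"
      proof (cases "1 - m - y \<le> 0")
        case True
        hence "x * (1 - m - y) \<le> 0" using bd by (simp add: mult_nonneg_nonpos)
        moreover have "0 \<le> y * (y - m)" "m < 1/2 \<Longrightarrow> 0 < y * (y - m)" using 2 m by auto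
        ultimately show ?thesis by (auto simp: B_def)
      next
        case False
        \<comment> \<open>Now \<open>B\<close> decreases in \<open>x\<close>, and at
          \<open>x = m\<close> it equals \<open>(y + 1/2) * (y - 1/2) + (1/2 - m)^2\<close>.\<close>
        hence "x * (1 - m - y) \<le> m * (1 - m - y)" using 2 by (intro mult_right_mono) auto
        moreover have "B = (y + 1/2) * (y - 1/2) + (1/2 - m)^2 + (m * (1 - m - y) - x * (1 - m - y))"
          unfolding B_def by algebra
        moreover have "0 \<le> (y + 1/2) * (y - 1/2)" using 2 by simp
        moreover have "0 \<le> (1/2 - m)^2" "m < 1/2 \<Longrightarrow> 0 < (1/2 - m)^2" by simp_all
        ultimately show ?thesis by linarith
      qed
      have id: "(x + y) * ((1 - m) * (1 - y) * U + m * (1 - x) * V)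
        = U * V - (m^2 * (1 - x - y)^2 + (1 - 2 * m) * x * B)"
        unfolding U_def V_def B_def by algebra
      have "(2 * a * b) * (U * V) = (x + y) * (b * (U * V))" by (simp add: a_def)
      also have "\<dots> \<le> (x + y) * (m * ((1 - m) * (1 - y) * U + m * (1 - x) * V))"
        using bd b by (intro mult_left_mono) auto
      also have "\<dots> = m * (U * V - (m^2 * (1 - x - y)^2 + (1 - 2 * m) * x * B))"
        by (simp only: id[symmetric]) (simp add: algebra_simps)
      finally have le: "(2 * a * b) * (U * V)
          \<le> m * (U * V) - m * (m^2 * (1 - x - y)^2 + (1 - 2 * m) * x * B)" 
        by (simp add: algebra_simps)
      have nn: "0 \<le> m^2 * (1 - x - y)^2" "0 \<le> (1 - 2 * m) * x * B" using m bd B by auto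
      have "0 \<le> m * (m^2 * (1 - x - y)^2 + (1 - 2 * m) * x * B)" using m nn by simp
      hence "(2 * a * b) * (U * V) \<le> m * (U * V)" using le by linarith
      hence "2 * a * b \<le> m" by (rule mult_right_le_imp_le) (use U V in simp)
      moreover have P if m': "m < 1/2" and eq: "2 * a * b = m"
      proof -
        \<comment> \<open>Both slack terms vanish: \<open>B > 0\<close> gives \<open>x = 0\<close>,
          and the square then gives \<open>y = 1\<close>. The odds bound leaves
          \<open>v = 0\<close>, and \<open>u = 1\<close> follows from the equality itself.\<close>
        have "m * (m^2 * (1 - x - y)^2 + (1 - 2 * m) * x * B) \<le> 0" using le eq by simp
        hence "m^2 * (1 - x - y)^2 + (1 - 2 * m) * x * B \<le> 0"
          using m by (simp add: mult_le_0_iff)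
        hence z: "m^2 * (1 - x - y)^2 = 0" "(1 - 2 * m) * x * B = 0" using nn by linarith+
        hence x: "x = 0" using m' B by auto
        moreover have "1 - x - y = 0" using z m by auto
        ultimately have y: "y = 1" by simp
        have "v * V \<le> 0" using vV y by simp
        hence v: "v = 0" using V bd by (simp add: mult_le_0_iff)
        have "u = 1" using eq x y v m by (simp add: a_def b_def)
        thus P using x y v by (simp add: P_def)
      qed
      ultimately show ?thesis by blast
    next
      case 3
      have y0: "0 < y" using y m by simp
      \<comment> \<open>With the product bound on \<open>v\<close> and the odds bound on
        \<open>u\<close>, multiplied through by \<open>2 * y * U\<close>, the slack is
        \<open>m * G\<close>.\<close>
      define G where "G = 2 * y * U - (x + y) * ((1 - m) * U + 2 * y * m * (1 - x))"
      have "0 < G"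
      proof -
        \<comment> \<open>As a function of \<open>y\<close>, \<open>G\<close> is concave with value \<open>G1\<close> at \<open>y = m\<close> and \<open>G2\<close> at \<open>y = 1/2\<close>.\<close>
        define G1 where "G1 = (m - x) * (m * (1 - m) + (1 - 3 * m) * x)"
        define G2 where "G2 = U - (x + 1/2) * ((1 - m) * U + m * (1 - x))"
        have "0 < G1"
        proof -
          have "m * (1 - m) + (1 - 3 * m) * x = ((m - x) * (1 - m) + x * (2 - 4 * m))"
            by (simp add: algebra_simps)
          moreover have "0 < (m - x) * (1 - m)" using 3 m by simp
          moreover have "0 \<le> x * (2 - 4 * m)" using bd m by simp
          ultimately show ?thesis using 3 by (simp add: G1_def)
        qed
        have "0 \<le> G2"
        proof -
          \<comment> \<open>At \<open>y = 1/2\<close> the two bounds on \<open>v\<close> agree, so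
            \<open>G2\<close> is twice the slack from the previous case there.\<close>
          have "G2 = 2 * (m^2 * (1/2 - x)^2 + (1 - 2 * m) * x * ((1/2 - m) * (1/2 - x)))"
            unfolding G2_def U_def by algebra
          thus ?thesis using m bd 3 by simp
        qed
        have "(1/2 - m) * G = (1/2 - y) * G1 + (y - m) * G2 + 2 * m * (1 - x) * (1/2 - y) * (y - m) * (1/2 - m)"
          unfolding G_def G1_def G2_def U_def by algebra
        moreover have "0 < (1/2 - y) * G1" using 3 \<open>0 < G1\<close> by simp
        moreover have "0 \<le> (y - m) * G2" using y \<open>0 \<le> G2\<close> by simp
        moreover have "0 \<le> 2 * m * (1 - x) * (1/2 - y) * (y - m) * (1/2 - m)"
          using m bd 3 y by (intro mult_nonneg_nonneg) auto
        ultimately have "0 < (1/2 - m) * G" by linarith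
        thus ?thesis using m by (simp add: zero_less_mult_iff)
      qed
      have "(2 * a * b) * (2 * y * U)
          = (x + y) * ((1 - m) * U * (2 * y * v) + 2 * y * m * (u * U))"
        unfolding a_def b_def by algebra
      also have "\<dots> \<le> (x + y) * ((1 - m) * U * m + 2 * y * m * (m * (1 - x)))"
        using m bd U by (intro mult_left_mono add_mono uU pyv) auto
      also have "\<dots> = m * (2 * y * U) - m * G" by (simp add: G_def algebra_simps)
      also have "\<dots> < m * (2 * y * U)" using m \<open>0 < G\<close> by simp
      finally have "2 * a * b < m" by (rule mult_right_less_imp_less) (use y0 U in simp)
      thus ?thesis by simp
    qed
  qed
  thus "2 * a * b \<le> m"
    and "m < 1/2 \<Longrightarrow> 2 * a * b = m \<Longrightarrow> x = y \<and> u = v \<or> x = 0 \<and> y = 1 \<and> v = 0 \<and> u = 1"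
    by (auto simp: P_def)
qed

section \<open>Reduction from general \<open>(p, q)\<close> to the two extreme pairs\<close>

lemma vertex_bound:
  fixes m p q b c :: real
  assumes "p \<le> 1/2" "q \<le> 1/2" "p * q \<le> m / 2" "0 \<le> b" "0 \<le> c"
  shows "b * p + c * q \<le> max (b / 2 + c * m) (b * m + c / 2)"
proof -
  \<comment> \<open>\<open>(p, q)\<close> lies on or below the line through the vertices \<open>(1/2, m)\<close> and \<open>(m, 1/2)\<close>.\<close>
  have "0 \<le> (1/2 - p) * (1/2 - q)" using assms by simp
  hence pq: "p + q \<le> 1/2 + m" using assms by (simp add: algebra_simps)
  show ?thesis
  \<comment> \<open>The common part of the coefficients is charged to
    \<open>p + q \<le> 1/2 + m\<close>, the excess of the larger one to its own bound
    \<open>1/2\<close>.\<close>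
  proof (cases "c \<le> b")
    case True
    have "b * p + c * q = c * (p + q) + (b - c) * p" by (simp add: algebra_simps)
    also have "\<dots> \<le> c * (1/2 + m) + (b - c) * (1/2)"
      by (intro add_mono mult_left_mono[OF pq] mult_left_mono[OF assms(1)]) (use assms True in auto)
    also have "\<dots> = b / 2 + c * m" by (simp add: field_simps)
    finally show ?thesis by simp
  next
    case False
    have "b * p + c * q = b * (p + q) + (c - b) * q" by (simp add: algebra_simps)
    also have "\<dots> \<le> b * (1/2 + m) + (c - b) * (1/2)"
      by (intro add_mono mult_left_mono[OF pq] mult_left_mono[OF assms(2)]) (use assms False in auto)
    also have "\<dots> = b * m + c / 2" by (simp add: field_simps)
    finally show ?thesis by simp
  qed
qed

text \<open>The choice \<open>l = 2\<close>, \<open>k = 0\<close> yields the product bound,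
  \<open>l = 1 - 2 * m\<close>, \<open>k = m\<close> the odds bound. Expanded in \<open>p\<close>
  and \<open>q\<close>, the \<open>p * q\<close> term is at most its common value at both vertices,
  and \<open>vertex_bound\<close> handles the linear terms.\<close>

lemma bilinear_vertex_bound:
  fixes m p q x y u v l k :: real
  assumes "p \<le> 1/2" "q \<le> 1/2" "p * q \<le> m / 2" and "0 \<le> x" "x \<le> y" "0 \<le> v" "v \<le> u"
    and "0 \<le> l" "0 \<le> k"
  defines "N \<equiv> \<lambda>a b. l * a * b + k * (a + b)"
  shows "N ((1 - p) * x + p * y) ((1 - q) * v + q * u)
    \<le> max (N ((x + y) / 2) ((1 - m) * v + m * u)) (N ((1 - m) * x + m * y) ((v + u) / 2))"
proof -
  define b c where "b = (l * v + k) * (y - x)" and "c = (l * x + k) * (u - v)"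
  have bc: "0 \<le> b" "0 \<le> c" using assms by (auto simp: b_def c_def)
  have expand: "N ((1 - p) * x + p * y) ((1 - q) * v + q * u)
    = N x v + (p * q) * (l * (y - x) * (u - v)) + (b * p + c * q)" for p q
    unfolding N_def b_def c_def by algebra
  have "(p * q) * (l * (y - x) * (u - v)) \<le> (m / 2) * (l * (y - x) * (u - v))"
    using assms by (intro mult_right_mono) auto
  with expand[of p q] vertex_bound[OF assms(1-3) bc]
  have "N ((1 - p) * x + p * y) ((1 - q) * v + q * u)
    \<le> max (N x v + (m / 2) * (l * (y - x) * (u - v)) + (b / 2 + c * m))
        (N x v + (m / 2) * (l * (y - x) * (u - v)) + (b * m + c / 2))"
    by linarith
  moreover have avg: "(1 - 1/2) * z + 1/2 * w = (z + w) / 2" for z w :: real by (simp add: field_simps)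
  ultimately show ?thesis
    using expand[of "1/2" m, unfolded avg] expand[of m "1/2", unfolded avg] by simp
qed

text \<open>Only the vertices \<open>(1/2, m)\<close> and \<open>(m, 1/2)\<close> for
  \<open>(p, q)\<close> need checking. The second becomes the first when the two families are
  exchanged, so the half-step lemmas apply again with \<open>v, u\<close> in place of
  \<open>x, y\<close>. Equality in the product bound forces equality at a vertex.\<close>

lemma feasible_step:
  fixes m p q x y u v :: real
  assumes m: "0 < m" "m \<le> 1/2" and pq: "0 \<le> p" "p \<le> 1/2" "0 \<le> q" "q \<le> 1/2" "p * q \<le> m / 2"
    and xy: "x \<le> y" and vu: "v \<le> u" and xu: "feasible m x u" and yv: "feasible m y v"
  defines "a \<equiv> (1 - p) * x + p * y" and "b \<equiv> (1 - q) * v + q * u"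
  shows "feasible m a b"
    and "m < 1/2 \<Longrightarrow> 2 * a * b = m \<Longrightarrow> x = y \<and> v = u \<or> x = 0 \<and> y = 1 \<and> v = 0 \<and> u = 1"
proof -
  have bd: "0 \<le> x" "x \<le> 1" "0 \<le> y" "y \<le> 1" "0 \<le> u" "u \<le> 1" "0 \<le> v" "v \<le> 1"
    and hxu: "(1 - 2 * m) * x * u + m * (x + u) \<le> m"
    and hyv: "(1 - 2 * m) * y * v + m * (y + v) \<le> m"
    using xu yv by (auto simp: feasible_def)
  have hux: "(1 - 2 * m) * u * x + m * (u + x) \<le> m"
    and hvy: "(1 - 2 * m) * v * y + m * (v + y) \<le> m"
    using hxu hyv by (simp_all add: algebra_simps)
  have ux: "feasible m u x" and vy: "feasible m v y"
    using xu yv feasible_commute by blast+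
  note half = product_bound_halfstep[OF m xy xu yv] product_bound_halfstep[OF m vu vy ux]
  let ?a1 = "(x + y) / 2" and ?b1 = "(1 - m) * v + m * u"
    and ?a2 = "(1 - m) * x + m * y" and ?b2 = "(v + u) / 2"
  have prod: "2 * a * b \<le> max (2 * ?a1 * ?b1) (2 * ?a2 * ?b2)"
    using bilinear_vertex_bound[OF pq(2,4,5) bd(1) xy bd(7) vu, of 2 0] by (simp add: a_def b_def)
  have le: "2 * ?a1 * ?b1 \<le> m" "2 * ?a2 * ?b2 \<le> m"
    by (rule half(1)) (use half(3) in \<open>simp only: mult_ac\<close>)
  show "feasible m a b" unfolding feasible_def
  proof (intro conjI)
    show "0 \<le> a" "0 \<le> b" using pq bd by (auto simp: a_def b_def)
    show "a \<le> 1" unfolding a_def using pq bd by (intro convex_bound_le) auto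
    show "b \<le> 1" unfolding b_def using pq bd by (intro convex_bound_le) auto
    show "2 * a * b \<le> m" using prod le by linarith
    have "(1 - 2 * m) * a * b + m * (a + b)
      \<le> max ((1 - 2 * m) * ?a1 * ?b1 + m * (?a1 + ?b1)) ((1 - 2 * m) * ?a2 * ?b2 + m * (?a2 + ?b2))"
      unfolding a_def b_def using m by (intro bilinear_vertex_bound pq bd xy vu) auto
    moreover have "(1 - 2 * m) * ?a1 * ?b1 + m * (?a1 + ?b1) \<le> m"
      by (rule odds_bound_halfstep[OF m bd(1) xy bd(4) hxu hyv])
    moreover have "(1 - 2 * m) * ?b2 * ?a2 + m * (?b2 + ?a2) \<le> m"
      by (rule odds_bound_halfstep[OF m bd(7) vu bd(6) hvy hux])
    hence "(1 - 2 * m) * ?a2 * ?b2 + m * (?a2 + ?b2) \<le> m"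
      by (simp only: mult_ac add_ac)
    ultimately show "(1 - 2 * m) * a * b + m * (a + b) \<le> m" by linarith
  qed
  assume m': "m < 1/2" and eq: "2 * a * b = m"
  have "2 * ?a1 * ?b1 = m \<or> 2 * ?a2 * ?b2 = m" using prod le eq by linarith
  thus "x = y \<and> v = u \<or> x = 0 \<and> y = 1 \<and> v = 0 \<and> u = 1"
  proof
    assume "2 * ?a1 * ?b1 = m"
    thus ?thesis using half(2)[OF m'] by auto
  next
    assume "2 * ?a2 * ?b2 = m"
    hence "2 * ?b2 * ?a2 = m" by (simp only: mult_ac)
    thus ?thesis using half(4)[OF m'] by auto
  qed
qed

section \<open>Product measures of set families\<close>

text \<open>The ground set is arbitrary, so that coordinates can be split off by induction and
  families can be measured on the subset \<open>I\<close>.\<close>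

definition product_measure :: "'a set \<Rightarrow> ('a \<Rightarrow> real) \<Rightarrow> 'a set set \<Rightarrow> real" where
  "product_measure S p F = (\<Sum>A\<in>F. (\<Prod>i\<in>A. p i) * (\<Prod>i\<in>S - A. 1 - p i))"

text \<open>The section of \<open>F\<close> over sets containing \<open>i\<close>; its counterpart
  over sets avoiding \<open>i\<close> is \<open>F \<inter> Pow S\<close>.\<close>

definition link :: "'a \<Rightarrow> 'a set \<Rightarrow> 'a set set \<Rightarrow> 'a set set" where
  "link i S F = {A \<in> Pow S. insert i A \<in> F}"

lemma product_measure_insert:
  assumes S: "finite S" "i \<notin> S" and F: "F \<subseteq> Pow (insert i S)"
  shows "product_measure (insert i S) p F
    = (1 - p i) * product_measure S p (F \<inter> Pow S) + p i * product_measure S p (link i S F)"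
proof -
  let ?w = "\<lambda>S A. (\<Prod>i\<in>A. p i) * (\<Prod>i\<in>S - A. 1 - p i)"
  have FU: "F = (F \<inter> Pow S) \<union> insert i ` link i S F"
  proof
    show "F \<subseteq> (F \<inter> Pow S) \<union> insert i ` link i S F"
    proof
      fix A assume A: "A \<in> F"
      show "A \<in> (F \<inter> Pow S) \<union> insert i ` link i S F"
      proof (cases "i \<in> A")
        case True
        hence "A = insert i (A - {i})" by auto
        moreover from this have "A - {i} \<in> link i S F" using A F by (auto simp: link_def)
        ultimately show ?thesis by blast
      next
        case False thus ?thesis using A F by auto
      qed
    qed
  qed (auto simp: link_def)
  have fin: "finite (F \<inter> Pow S)" "finite (link i S F)" using S by (auto simp: link_def)
  have inj: "inj_on (insert i) (link i S F)"
  proof (rule inj_onI)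
    fix A B assume "A \<in> link i S F" "B \<in> link i S F" and eq: "insert i A = insert i B"
    hence "i \<notin> A" "i \<notin> B" using S by (auto simp: link_def)
    thus "A = B" using eq by (simp add: insert_ident)
  qed
  have "product_measure (insert i S) p F
    = sum (?w (insert i S)) (F \<inter> Pow S) + sum (?w (insert i S)) (insert i ` link i S F)"
    unfolding product_measure_def
    by (rule trans[OF arg_cong[OF FU, of "sum (?w (insert i S))"] sum.union_disjoint]) (use fin S in auto)
  also have "sum (?w (insert i S)) (F \<inter> Pow S) = (1 - p i) * product_measure S p (F \<inter> Pow S)"
    unfolding product_measure_def sum_distrib_left
  proof (rule sum.cong[OF refl])
    fix A assume "A \<in> F \<inter> Pow S"
    hence "insert i S - A = insert i (S - A)" "i \<notin> S - A" using S by auto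
    thus "?w (insert i S) A = (1 - p i) * ?w S A" using S by simp
  qed
  also have "sum (?w (insert i S)) (insert i ` link i S F)
    = p i * product_measure S p (link i S F)"
    unfolding product_measure_def sum_distrib_left sum.reindex[OF inj] comp_def
  proof (rule sum.cong[OF refl])
    fix A assume A: "A \<in> link i S F"
    hence "i \<notin> A" "finite A" "insert i S - insert i A = S - A"
      using S by (auto simp: link_def intro: finite_subset)
    thus "?w (insert i S) (insert i A) = p i * ?w S A" by simp
  qed
  finally show ?thesis .
qed

lemma product_measure_Pow: "finite S \<Longrightarrow> product_measure S p (Pow S) = 1"
proof (induction S rule: finite_induct)
  case empty
  thus ?case by (simp add: product_measure_def)
next
  case (insert i S)
  have "Pow (insert i S) \<inter> Pow S = Pow S" "link i S (Pow (insert i S)) = Pow S"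
    by (auto simp: link_def)
  thus ?case using insert by (simp add: product_measure_insert)
qed

lemma product_weight_pos:
  fixes p :: "'a \<Rightarrow> real"
  assumes "\<forall>i\<in>S. 0 < p i \<and> p i < 1" "A \<subseteq> S"
  shows "0 < (\<Prod>i\<in>A. p i) * (\<Prod>i\<in>S - A. 1 - p i)"
  using assms by (intro mult_pos_pos prod_pos) auto

lemma product_measure_nonneg:
  assumes "\<forall>i\<in>S. 0 < p i \<and> p i < 1" "F \<subseteq> Pow S"
  shows "0 \<le> product_measure S p F"
  unfolding product_measure_def
  using product_weight_pos[OF assms(1)] assms(2) by (intro sum_nonneg) (meson PowD less_imp_le subsetD)

lemma product_measure_mono:
  assumes "finite S" "\<forall>i\<in>S. 0 < p i \<and> p i < 1" "F \<subseteq> G" "G \<subseteq> Pow S"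
  shows "product_measure S p F \<le> product_measure S p G"
  unfolding product_measure_def
proof (rule sum_mono2)
  show "finite G" using assms by (meson finite_Pow_iff finite_subset)
  fix A assume "A \<in> G - F"
  thus "0 \<le> (\<Prod>i\<in>A. p i) * (\<Prod>i\<in>S - A. 1 - p i)"
    using product_weight_pos[OF assms(2), of A] assms(4) by auto
qed (fact assms(3))

text \<open>Every single set has positive weight. This turns numerical equality in the induction
  step into equality of sections.\<close>

lemma product_measure_eq_imp_eq:
  assumes "finite S" "\<forall>i\<in>S. 0 < p i \<and> p i < 1" "F \<subseteq> G" "G \<subseteq> Pow S"
    and eq: "product_measure S p F = product_measure S p G"
  shows "F = G"
proof (rule ccontr)
  assume "F \<noteq> G"
  then obtain A where A: "A \<in> G" "A \<notin> F" using assms(3) by auto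
  have fin: "finite G" using assms by (meson finite_Pow_iff finite_subset)
  have "product_measure S p F < product_measure S p G"
    unfolding product_measure_def
  proof (rule sum_strict_mono2[OF fin assms(3), of A])
    show "A \<in> G - F" using A by simp
    show "0 < (\<Prod>i\<in>A. p i) * (\<Prod>i\<in>S - A. 1 - p i)"
      using product_weight_pos[OF assms(2)] A assms(4) by auto
    fix B assume "B \<in> G"
    thus "0 \<le> (\<Prod>i\<in>B. p i) * (\<Prod>i\<in>S - B. 1 - p i)"
      using product_weight_pos[OF assms(2), of B] assms(4) by auto
  qed
  thus False using eq by simp
qed

text \<open>Both sections along a coordinate of \<open>D\<close> coincide, so its weights
  \<open>1 - p i\<close> and \<open>p i\<close> add up to 1.\<close>

lemma product_measure_preimage:
  assumes "finite I" "finite D" "I \<inter> D = {}" "H \<subseteq> Pow I"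
  shows "product_measure (I \<union> D) p {A. A \<subseteq> I \<union> D \<and> A \<inter> I \<in> H} = product_measure I p H"
  using assms(2,3)
proof (induction D rule: finite_induct)
  case empty
  have "{A. A \<subseteq> I \<union> {} \<and> A \<inter> I \<in> H} = H" using assms(4) by (auto simp: Int_absorb2)
  thus ?case by simp
next
  case (insert i D)
  let ?F = "{A. A \<subseteq> I \<union> insert i D \<and> A \<inter> I \<in> H}" and ?G = "{A. A \<subseteq> I \<union> D \<and> A \<inter> I \<in> H}"
  have i: "i \<notin> I \<union> D" using insert by auto
  have "?F \<inter> Pow (I \<union> D) = ?G" by auto
  moreover have "link i (I \<union> D) ?F = ?G" using i by (auto simp: link_def)
  ultimately have "product_measure (insert i (I \<union> D)) p ?F = product_measure (I \<union> D) p ?G"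
    using insert assms(1) i
    by (subst product_measure_insert) (auto simp: algebra_simps)
  thus ?case using insert by simp
qed

lemma product_measure_half:
  assumes "finite I" "\<forall>i\<in>I. p i = 1/2" "H \<subseteq> Pow I"
  shows "product_measure I p H = card H / 2 ^ card I"
proof -
  have "product_measure I p H = (\<Sum>A\<in>H. (1/2) ^ card I)"
    unfolding product_measure_def
  proof (rule sum.cong[OF refl])
    fix A assume "A \<in> H"
    hence A: "A \<subseteq> I" "finite A" using assms by (auto intro: finite_subset)
    have "(\<Prod>i\<in>A. p i) = (1/2) ^ card A" using A assms by (subst prod.cong[OF refl, of _ _ "\<lambda>_. 1/2"]) auto
    moreover have "(\<Prod>i\<in>I - A. 1 - p i) = (1/2) ^ card (I - A)"
      using A assms by (subst prod.cong[OF refl, of _ _ "\<lambda>_. 1/2"]) auto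
    moreover have "card I = card A + card (I - A)"
      using A assms by (simp add: card_Diff_subset card_mono)
    ultimately show "(\<Prod>i\<in>A. p i) * (\<Prod>i\<in>I - A. 1 - p i) = (1/2) ^ card I"
      by (simp add: power_add)
  qed
  thus ?thesis by (simp add: power_one_over)
qed

lemma product_measure_star:
  assumes "finite S" "j \<in> S"
  shows "product_measure S p {A. A \<subseteq> S \<and> j \<in> A} = p j"
proof -
  have "S = {j} \<union> (S - {j})" and "{A. A \<subseteq> S \<and> j \<in> A} = {A. A \<subseteq> S \<and> A \<inter> {j} \<in> {{j}}}"
    using assms by auto
  hence "product_measure S p {A. A \<subseteq> S \<and> j \<in> A} = product_measure {j} p {{j}}"
    using product_measure_preimage[of "{j}" "S - {j}" "{{j}}" p] assms by simp
  thus ?thesis by (simp add: product_measure_def)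
qed

section \<open>Increasing cross-intersecting families\<close>

lemma link_subset: "link i S F \<subseteq> Pow S"
  by (auto simp: link_def)

lemma increasing_restrict:
  assumes "increasing_family (insert i S) F"
  shows "increasing_family S (F \<inter> Pow S)" "increasing_family S (link i S F)"
    "F \<inter> Pow S \<subseteq> link i S F"
proof -
  have *: "B \<in> F" if "A \<in> F" "A \<subseteq> B" "B \<subseteq> insert i S" for A B
    using assms that unfolding increasing_family_def by blast
  show "increasing_family S (F \<inter> Pow S)" "increasing_family S (link i S F)"
    using * unfolding increasing_family_def link_def by (auto, blast, (meson insert_mono)+)
  show "F \<inter> Pow S \<subseteq> link i S F" using * by (auto simp: link_def) blast
qed

text \<open>Two sets containing \<open>i\<close> may meet in \<open>i\<close> alone, so only the
  mixed pairs of sections are sure to stay cross-intersecting.\<close>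

lemma cross_intersecting_link:
  assumes "cross_intersecting F G" "i \<notin> S"
  shows "cross_intersecting (F \<inter> Pow S) (link i S G)" "cross_intersecting (link i S F) (G \<inter> Pow S)"
proof -
  have *: "A \<inter> B \<noteq> {}" if "A \<in> F" "B \<in> G" for A B
    using assms(1) that unfolding cross_intersecting_def by blast
  have "A \<inter> B \<noteq> {}" if "A \<in> F \<inter> Pow S" "B \<in> link i S G" for A B
    using *[of A "insert i B"] that assms(2) by (auto simp: link_def)
  thus "cross_intersecting (F \<inter> Pow S) (link i S G)" unfolding cross_intersecting_def by blast
  have "A \<inter> B \<noteq> {}" if "A \<in> link i S F" "B \<in> G \<inter> Pow S" for A B
    using *[of "insert i A" B] that assms(2) by (auto simp: link_def)
  thus "cross_intersecting (link i S F) (G \<inter> Pow S)" unfolding cross_intersecting_def by blast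
qed

text \<open>Induction on the ground set: the mixed sections satisfy the induction hypothesis, and
  monotonicity of the families supplies \<open>x \<le> y\<close> and \<open>v \<le> u\<close> for
  \<open>feasible_step\<close>.\<close>

lemma product_measure_feasible:
  assumes "finite S" "\<forall>i\<in>S. 0 < p i \<and> p i \<le> 1/2" "\<forall>i\<in>S. 0 < q i \<and> q i \<le> 1/2"
    and m: "0 < m" "m \<le> 1/2" and "\<forall>i\<in>S. p i * q i \<le> m / 2"
    and "increasing_family S F" "increasing_family S G" "cross_intersecting F G"
  shows "feasible m (product_measure S p F) (product_measure S q G)"
  using assms(1-3,6-)
proof (induction S arbitrary: F G rule: finite_induct)
  case empty
  \<comment> \<open>The empty set does not meet itself, so one family is empty; a pair
    \<open>(0, b)\<close> with \<open>0 \<le> b \<le> 1\<close> is feasible.\<close>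
  hence "F \<subseteq> {{}}" "G \<subseteq> {{}}" "F = {} \<or> G = {}"
    unfolding increasing_family_def cross_intersecting_def by auto
  thus ?case using m by (auto simp: feasible_def product_measure_def subset_singleton_iff)
next
  case (insert i S)
  note incF = increasing_restrict[OF insert.prems(4)]
    and incG = increasing_restrict[OF insert.prems(5)]
    and cr = cross_intersecting_link[OF insert.prems(6) insert.hyps(2)]
  have F: "F \<subseteq> Pow (insert i S)" "G \<subseteq> Pow (insert i S)"
    using insert.prems unfolding increasing_family_def by auto
  show ?case
    unfolding product_measure_insert[OF insert.hyps F(1)] product_measure_insert[OF insert.hyps F(2)]
  proof (rule feasible_step(1)[OF m])
    show "feasible m (product_measure S p (F \<inter> Pow S)) (product_measure S q (link i S G))"
      using insert.prems by (intro insert.IH incF incG cr) auto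
    show "feasible m (product_measure S p (link i S F)) (product_measure S q (G \<inter> Pow S))"
      using insert.prems by (intro insert.IH incF incG cr) auto
    show "product_measure S p (F \<inter> Pow S) \<le> product_measure S p (link i S F)"
      using insert by (intro product_measure_mono incF link_subset) fastforce+
    show "product_measure S q (G \<inter> Pow S) \<le> product_measure S q (link i S G)"
      using insert by (intro product_measure_mono incG link_subset) fastforce+
  qed (use insert.prems in auto)
qed

lemma mem_iff_of_link_eq:
  assumes "F \<inter> Pow S = link i S F" "A \<subseteq> insert i S" "i \<notin> S"
  shows "A \<in> F \<longleftrightarrow> A - {i} \<in> F"
proof (cases "i \<in> A")
  case True
  define B where "B = A - {i}"
  have B: "B \<in> Pow S" "A = insert i B" using True assms(2) by (auto simp: B_def)
  hence "A \<in> F \<longleftrightarrow> B \<in> link i S F" by (simp add: link_def)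
  also have "\<dots> \<longleftrightarrow> B \<in> F" using B(1) by (simp flip: assms(1))
  finally show ?thesis unfolding B_def .
qed simp

text \<open>Follow equality through the induction. Equal sections mean that \<open>i\<close> is
  irrelevant, and the star comes from the smaller ground set; sections of measure 0 and 1 mean a
  star at \<open>i\<close>, and the equality becomes \<open>2 * p i * q i = m\<close>. The empty
  ground set is excluded by \<open>m > 0\<close>.\<close>

lemma product_measure_equality:
  assumes "finite S" "\<forall>i\<in>S. 0 < p i \<and> p i \<le> 1/2" "\<forall>i\<in>S. 0 < q i \<and> q i \<le> 1/2"
    and m: "0 < m" "m < 1/2" and "\<forall>i\<in>S. p i * q i \<le> m / 2"
    and "increasing_family S F" "increasing_family S G" "cross_intersecting F G"
    and "2 * product_measure S p F * product_measure S q G = m"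
  shows "\<exists>j\<in>S. p j * q j = m / 2 \<and> F = {A. A \<subseteq> S \<and> j \<in> A} \<and> G = {A. A \<subseteq> S \<and> j \<in> A}"
  using assms(1-3,6-)
proof (induction S arbitrary: F G rule: finite_induct)
  case empty
  hence "F \<subseteq> {{}}" "G \<subseteq> {{}}" "F = {} \<or> G = {}"
    unfolding increasing_family_def cross_intersecting_def by auto
  thus ?case using m empty by (auto simp: product_measure_def)
next
  case (insert i S)
  note incF = increasing_restrict[OF insert.prems(4)]
    and incG = increasing_restrict[OF insert.prems(5)]
    and cr = cross_intersecting_link[OF insert.prems(6) insert.hyps(2)]
  have F: "F \<subseteq> Pow (insert i S)" and G: "G \<subseteq> Pow (insert i S)"
    using insert.prems unfolding increasing_family_def by auto
  have p1: "\<forall>i\<in>S. 0 < p i \<and> p i < 1" and q1: "\<forall>i\<in>S. 0 < q i \<and> q i < 1"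
    using insert.prems(1,2) by fastforce+
  note eqF = product_measure_eq_imp_eq[OF insert.hyps(1) p1]
    and eqG = product_measure_eq_imp_eq[OF insert.hyps(1) q1]
  let ?x = "product_measure S p (F \<inter> Pow S)" and ?y = "product_measure S p (link i S F)"
    and ?v = "product_measure S q (G \<inter> Pow S)" and ?u = "product_measure S q (link i S G)"
  have eq: "2 * ((1 - p i) * ?x + p i * ?y) * ((1 - q i) * ?v + q i * ?u) = m"
    using insert.prems(7) unfolding product_measure_insert[OF insert.hyps F]
      product_measure_insert[OF insert.hyps G] .
  have "?x = ?y \<and> ?v = ?u \<or> ?x = 0 \<and> ?y = 1 \<and> ?v = 0 \<and> ?u = 1"
  proof (rule feasible_step(2)[OF _ _ _ _ _ _ _ _ _ _ _ _ eq])
    show "feasible m ?x ?u" "feasible m ?y ?v"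
      using insert.prems insert.hyps m
      by (auto intro!: product_measure_feasible incF incG cr)
    show "?x \<le> ?y" by (intro product_measure_mono incF link_subset insert.hyps p1)
    show "?v \<le> ?u" by (intro product_measure_mono incG link_subset insert.hyps q1)
  qed (use insert.prems m in auto)
  thus ?case
  proof
    assume *: "?x = ?y \<and> ?v = ?u"
    have lF: "F \<inter> Pow S = link i S F" using * by (intro eqF incF link_subset) auto
    have lG: "G \<inter> Pow S = link i S G" using * by (intro eqG incG link_subset) auto
    have "2 * ?x * ?v = m" using eq * by (simp add: algebra_simps)
    hence "\<exists>j\<in>S. p j * q j = m / 2 \<and> F \<inter> Pow S = {A. A \<subseteq> S \<and> j \<in> A} \<and> G \<inter> Pow S = {A. A \<subseteq> S \<and> j \<in> A}"
      using insert.prems incF incG cr lF lG by (intro insert.IH) auto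
    then obtain j where j: "j \<in> S" "p j * q j = m / 2"
      and FG: "F \<inter> Pow S = {A. A \<subseteq> S \<and> j \<in> A}" "G \<inter> Pow S = {A. A \<subseteq> S \<and> j \<in> A}"
      by blast
    have ij: "i \<noteq> j" using j insert.hyps by auto
    have mem: "A \<in> H \<longleftrightarrow> j \<in> A"
      if A: "A \<subseteq> insert i S" and H: "H \<inter> Pow S = link i S H" "H \<inter> Pow S = {A. A \<subseteq> S \<and> j \<in> A}" for A H
    proof -
      have "A \<in> H \<longleftrightarrow> A - {i} \<in> H \<inter> Pow S"
        using mem_iff_of_link_eq[OF H(1) A insert.hyps(2)] A by auto
      thus ?thesis unfolding H(2) using A ij by auto
    qed
    have "F = {A. A \<subseteq> insert i S \<and> j \<in> A}" "G = {A. A \<subseteq> insert i S \<and> j \<in> A}"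
      using F mem[OF _ lF FG(1)] G mem[OF _ lG FG(2)] by auto
    thus ?thesis using j by blast
  next
    assume *: "?x = 0 \<and> ?y = 1 \<and> ?v = 0 \<and> ?u = 1"
    have F0: "{} = F \<inter> Pow S" using * by (intro eqF) (auto simp: product_measure_def)
    have F1: "link i S F = Pow S"
      using * insert.hyps by (intro eqF link_subset) (auto simp: product_measure_Pow)
    have G0: "{} = G \<inter> Pow S" using * by (intro eqG) (auto simp: product_measure_def)
    have G1: "link i S G = Pow S"
      using * insert.hyps by (intro eqG link_subset) (auto simp: product_measure_Pow)
    have full: "H = {A. A \<subseteq> insert i S \<and> i \<in> A}"
      if H: "{} = H \<inter> Pow S" "link i S H = Pow S" "H \<subseteq> Pow (insert i S)" for H
    proof (intro equalityI subsetI)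
      fix A assume "A \<in> H" thus "A \<in> {A. A \<subseteq> insert i S \<and> i \<in> A}" using H(1,3) by auto
    next
      fix A assume A: "A \<in> {A. A \<subseteq> insert i S \<and> i \<in> A}"
      hence "A - {i} \<in> link i S H" unfolding H(2) by auto
      thus "A \<in> H" using A by (auto simp: link_def insert_absorb)
    qed
    moreover have "p i * q i = m / 2" using eq * by simp
    ultimately show ?thesis using full[OF F0 F1 F] full[OF G0 G1 G] by blast
  qed
qed

section \<open>Tools for equality at \<open>m = 1/2\<close>: irrelevant coordinates and dual
  families\<close>

lemma irrelevant_coordinate:
  assumes "finite S" "\<forall>i\<in>S. 0 < p i \<and> p i \<le> 1/2" "\<forall>i\<in>S. 0 < q i \<and> q i \<le> 1/2"
    and inc: "increasing_family S F" "increasing_family S G" "cross_intersecting F G"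
    and sum: "product_measure S p F + product_measure S q G = 1"
    and i: "i \<in> S" "p i + q i < 1" and A: "A \<subseteq> S"
  shows "A \<in> F \<longleftrightarrow> A - {i} \<in> F" "A \<in> G \<longleftrightarrow> A - {i} \<in> G"
proof -
  define T where "T = S - {i}"
  have T: "finite T" "i \<notin> T" "S = insert i T" using assms by (auto simp: T_def)
  note incF = increasing_restrict[OF inc(1)[unfolded T(3)]]
    and incG = increasing_restrict[OF inc(2)[unfolded T(3)]]
    and cr = cross_intersecting_link[OF inc(3) T(2)]
  have F: "F \<subseteq> Pow (insert i T)" and G: "G \<subseteq> Pow (insert i T)"
    using inc T(3) unfolding increasing_family_def by auto
  have p1: "\<forall>i\<in>T. 0 < p i \<and> p i < 1" and q1: "\<forall>i\<in>T. 0 < q i \<and> q i < 1"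
    using assms(2,3) T(3) by fastforce+
  let ?x = "product_measure T p (F \<inter> Pow T)" and ?y = "product_measure T p (link i T F)"
    and ?v = "product_measure T q (G \<inter> Pow T)" and ?u = "product_measure T q (link i T G)"
  have pq: "p j * q j \<le> (1/2) / 2" if "j \<in> T" for j
    using mult_mono[of "p j" "1/2" "q j" "1/2"] that assms(2,3) T(3) by auto
  have "feasible (1/2) ?x ?u" "feasible (1/2) ?y ?v"
    using assms(2,3) T pq by (auto intro!: product_measure_feasible incF incG cr)
  hence 1: "?x + ?u \<le> 1" "?y + ?v \<le> 1" by (auto simp: feasible_def)
  have 2: "?x \<le> ?y" by (intro product_measure_mono incF link_subset T p1)
  have 3: "?v \<le> ?u" by (intro product_measure_mono incG link_subset T q1)
  have pos: "0 < p i" "0 < q i" using assms by auto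
  have "(1 - p i) * ?x + p i * ?y + ((1 - q i) * ?v + q i * ?u) = 1"
    using sum unfolding T(3) product_measure_insert[OF T(1,2) F] product_measure_insert[OF T(1,2) G] .
  \<comment> \<open>The deficit \<open>1 - (a + b)\<close> is a combination of the deficits of
    \<open>(x, u)\<close>, \<open>(y, v)\<close> and \<open>(x, v)\<close> with weights
    \<open>q i\<close>, \<open>p i\<close> and \<open>1 - p i - q i\<close>. All weights are
    positive, so all three deficits vanish, whence \<open>x = y\<close> and
    \<open>v = u\<close>.\<close>
  hence eq: "q i * (1 - (?x + ?u)) + p i * (1 - (?y + ?v)) + (1 - p i - q i) * (1 - (?x + ?v)) = 0"
    by (simp add: algebra_simps)
  have "0 \<le> q i * (1 - (?x + ?u))" "0 \<le> p i * (1 - (?y + ?v))"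
    "0 \<le> (1 - p i - q i) * (1 - (?x + ?v))"
    using 1 2 3 pos i by auto
  hence "q i * (1 - (?x + ?u)) = 0" "p i * (1 - (?y + ?v)) = 0" "(1 - p i - q i) * (1 - (?x + ?v)) = 0"
    using eq by linarith+
  hence "?x = ?y" "?v = ?u" using pos i by auto
  hence "F \<inter> Pow T = link i T F" "G \<inter> Pow T = link i T G"
    using product_measure_eq_imp_eq[OF T(1) p1 incF(3) link_subset]
      product_measure_eq_imp_eq[OF T(1) q1 incG(3) link_subset] by auto
  thus "A \<in> F \<longleftrightarrow> A - {i} \<in> F" "A \<in> G \<longleftrightarrow> A - {i} \<in> G"
    using mem_iff_of_link_eq[OF _ _ T(2)] A T(3) by blast+
qed

lemma mem_iff_Diff_irrelevant:
  assumes "finite D" "\<And>i A. i \<in> D \<Longrightarrow> A \<subseteq> S \<Longrightarrow> A \<in> F \<longleftrightarrow> A - {i} \<in> F" "A \<subseteq> S"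
  shows "A \<in> F \<longleftrightarrow> A - D \<in> F"
  using assms
proof (induction D rule: finite_induct)
  case (insert i D)
  have "A \<in> F \<longleftrightarrow> A - D \<in> F" using insert by blast
  also have "\<dots> \<longleftrightarrow> A - D - {i} \<in> F" using insert by blast
  also have "A - D - {i} = A - insert i D" by auto
  finally show ?case .
qed simp

text \<open>A set \<open>T\<close> meets every member of \<open>H\<close> iff no member lies inside
  \<open>X - T\<close>, which for increasing \<open>H\<close> means \<open>X - T \<notin> H\<close>.
  So the dual is the complement of the image of \<open>H\<close> under complementation.\<close>

lemma card_dual_family:
  assumes "finite X" "increasing_family X H"
  shows "card (dual_family X H) = 2 ^ card X - card H"
proof -
  have H: "H \<subseteq> Pow X" using assms(2) unfolding increasing_family_def by blast
  have "dual_family X H = Pow X - (\<lambda>A. X - A) ` H"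
  proof (intro equalityI subsetI)
    fix T assume "T \<in> dual_family X H"
    thus "T \<in> Pow X - (\<lambda>A. X - A) ` H" by (auto simp: dual_family_def)
  next
    fix T assume T: "T \<in> Pow X - (\<lambda>A. X - A) ` H"
    hence nH: "X - T \<notin> H" by (metis Diff_iff Pow_iff double_diff image_eqI subset_refl)
    have "T \<inter> A \<noteq> {}" if "A \<in> H" for A
    proof
      assume "T \<inter> A = {}"
      hence "A \<subseteq> X - T" using that H by auto
      hence "X - T \<in> H" using assms(2) that unfolding increasing_family_def by blast
      thus False using nH by blast
    qed
    thus "T \<in> dual_family X H" using T by (auto simp: dual_family_def)
  qed
  moreover have "inj_on (\<lambda>A. X - A) H" using H by (intro inj_onI) blast
  moreover have "(\<lambda>A. X - A) ` H \<subseteq> Pow X" by auto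
  ultimately show ?thesis using assms(1) H
    by (simp add: card_Diff_subset card_image card_Pow finite_subset[OF H])
qed

section \<open>Reduction of arbitrary families to increasing ones\<close>

definition up_closure :: "'a set \<Rightarrow> 'a set set \<Rightarrow> 'a set set" where
  "up_closure S F = {B. B \<subseteq> S \<and> (\<exists>A\<in>F. A \<subseteq> B)}"

lemma increasing_up_closure: "increasing_family S (up_closure S F)"
  by (auto simp: increasing_family_def up_closure_def)

lemma subset_up_closure: "F \<subseteq> Pow S \<Longrightarrow> F \<subseteq> up_closure S F"
  unfolding up_closure_def by blast

lemma cross_intersecting_up_closure:
  assumes "cross_intersecting F G"
  shows "cross_intersecting (up_closure S F) (up_closure S G)"
  unfolding cross_intersecting_def
proof (intro ballI)
  fix A B assume "A \<in> up_closure S F" "B \<in> up_closure S G"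
  then obtain A' B' where "A' \<in> F" "A' \<subseteq> A" "B' \<in> G" "B' \<subseteq> B"
    by (auto simp: up_closure_def)
  moreover from this have "A' \<inter> B' \<noteq> {}" using assms by (simp add: cross_intersecting_def)
  ultimately show "A \<inter> B \<noteq> {}" by blast
qed

text \<open>Up-closures stay cross-intersecting and have at least the same measures, so the bound
  for increasing families carries over. At equality neither measure can grow, and each family is its
  own up-closure.\<close>

lemma product_measure_cross_intersecting:
  assumes S: "finite S" and p: "\<forall>i\<in>S. 0 < p i \<and> p i \<le> 1/2" and q: "\<forall>i\<in>S. 0 < q i \<and> q i \<le> 1/2"
    and m: "0 < m" "m \<le> 1/2" and pq: "\<forall>i\<in>S. p i * q i \<le> m / 2"
    and FG: "F \<subseteq> Pow S" "G \<subseteq> Pow S" "cross_intersecting F G"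
  shows "product_measure S p F * product_measure S q G \<le> m / 2"
    and "product_measure S p F * product_measure S q G = m / 2 \<Longrightarrow>
      increasing_family S F \<and> increasing_family S G"
proof -
  let ?F = "up_closure S F" and ?G = "up_closure S G"
  have p1: "\<forall>i\<in>S. 0 < p i \<and> p i < 1" and q1: "\<forall>i\<in>S. 0 < q i \<and> q i < 1"
    using p q by fastforce+
  have sub: "?F \<subseteq> Pow S" "?G \<subseteq> Pow S" by (auto simp: up_closure_def)
  have "feasible m (product_measure S p ?F) (product_measure S q ?G)"
    by (intro product_measure_feasible increasing_up_closure cross_intersecting_up_closure assms)
  hence le: "product_measure S p ?F * product_measure S q ?G \<le> m / 2"
    by (simp add: feasible_def)
  have monoF: "product_measure S p F \<le> product_measure S p ?F"
    by (intro product_measure_mono subset_up_closure sub S p1 FG)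
  have monoG: "product_measure S q G \<le> product_measure S q ?G"
    by (intro product_measure_mono subset_up_closure sub S q1 FG)
  have nn: "0 \<le> product_measure S p F" "0 \<le> product_measure S q G"
    using product_measure_nonneg[OF p1 FG(1)] product_measure_nonneg[OF q1 FG(2)] by auto
  have "product_measure S p F * product_measure S q G
    \<le> product_measure S p ?F * product_measure S q ?G"
    using monoF monoG nn by (intro mult_mono) auto
  thus "product_measure S p F * product_measure S q G \<le> m / 2" using le by simp
  assume eq: "product_measure S p F * product_measure S q G = m / 2"
  have pos: "0 < product_measure S p F" "0 < product_measure S q G"
    using eq m nn by (auto simp: less_le)
  \<comment> \<open>Closing one family at a time cannot raise the product above
    \<open>m / 2\<close>; cancelling the other, positive measure shows that closing adds
    nothing.\<close>
  have "product_measure S p ?F * product_measure S q G \<le> product_measure S p ?F * product_measure S q ?G"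
    "product_measure S p F * product_measure S q ?G \<le> product_measure S p ?F * product_measure S q ?G"
    using monoF monoG nn by (auto intro!: mult_left_mono mult_right_mono)
  hence "product_measure S p ?F * product_measure S q G \<le> product_measure S p F * product_measure S q G"
    "product_measure S p F * product_measure S q ?G \<le> product_measure S p F * product_measure S q G"
    using le eq by linarith+
  hence "product_measure S p ?F \<le> product_measure S p F" "product_measure S q ?G \<le> product_measure S q G"
    using pos by (auto dest: mult_right_le_imp_le mult_left_le_imp_le)
  hence "F = ?F" "G = ?G"
    using product_measure_eq_imp_eq[OF S p1 subset_up_closure[OF FG(1)] sub(1)]
      product_measure_eq_imp_eq[OF S q1 subset_up_closure[OF FG(2)] sub(2)] monoF monoG by auto
  thus "increasing_family S F \<and> increasing_family S G" using increasing_up_closure by metis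
qed

section \<open>The extremal pairs of product 1/4\<close>

lemma mult_eq_quarter_iff:
  fixes a b :: real
  assumes "0 < a" "a \<le> 1/2" "0 < b" "b \<le> 1/2"
  shows "a * b = 1/4 \<longleftrightarrow> a = 1/2 \<and> b = 1/2"
proof
  assume ab: "a * b = 1/4"
  have "a * b \<le> a * (1/2)" "a * b \<le> (1/2) * b"
    using assms by (auto intro!: mult_left_mono mult_right_mono)
  thus "a = 1/2 \<and> b = 1/2" using ab assms by auto
next
  assume "a = 1/2 \<and> b = 1/2"
  thus "a * b = 1/4" by (elim conjE, hypsubst, simp)
qed

text \<open>Equality forces both measures to be \<open>1/2\<close>, so their sum is 1 and
  coordinates outside \<open>I\<close> are irrelevant. On \<open>I\<close> the measure is uniform,
  and measure \<open>1/2\<close> means \<open>2 ^ (card I - 1)\<close> sets. The witness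
  \<open>H\<close> is the trace of \<open>F\<close> on \<open>I\<close>.\<close>

lemma product_measure_quarter:
  fixes p q :: "'a \<Rightarrow> real"
  assumes S: "finite S" and p: "\<forall>i\<in>S. 0 < p i \<and> p i \<le> 1/2" and q: "\<forall>i\<in>S. 0 < q i \<and> q i \<le> 1/2"
    and I: "I = {i\<in>S. p i = 1/2 \<and> q i = 1/2}" "I \<noteq> {}"
    and FG: "F \<subseteq> Pow S" "G \<subseteq> Pow S" "cross_intersecting F G"
  shows "product_measure S p F * product_measure S q G = 1/4 \<longleftrightarrow>
    (\<exists>H. increasing_family I H \<and> card H = 2 ^ (card I - 1) \<and>
      F = {A. A \<subseteq> S \<and> A \<inter> I \<in> H} \<and> G = {B. B \<subseteq> S \<and> B \<inter> I \<in> dual_family I H})"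
    (is "?L \<longleftrightarrow> ?R")
proof -
  have I': "I \<subseteq> S" "finite I" "\<forall>i\<in>I. p i = 1/2" "\<forall>i\<in>I. q i = 1/2" using I S by auto
  have "0 < card I" using I' I(2) by (simp add: card_gt_0_iff)
  \<comment> \<open>Nonemptiness of \<open>I\<close> makes \<open>card I - 1\<close> a true
    predecessor. The equation is used over both \<open>nat\<close> and \<open>real\<close>.\<close>
  hence two: "(2::'b::comm_semiring_1) ^ card I = 2 * 2 ^ (card I - 1)"
    by (simp flip: power_Suc)
  have measure: "product_measure S r {A. A \<subseteq> S \<and> A \<inter> I \<in> H} = card H / (2 * 2 ^ (card I - 1))"
    if "H \<subseteq> Pow I" "\<forall>i\<in>I. r i = 1/2" for H r
  proof -
    have "S = I \<union> (S - I)" using I' by auto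
    hence "product_measure S r {A. A \<subseteq> S \<and> A \<inter> I \<in> H} = product_measure I r H"
      using product_measure_preimage[of I "S - I" H r] that I' S by simp
    also have "\<dots> = card H / 2 ^ card I" by (rule product_measure_half) (use that I' in auto)
    finally show ?thesis by (simp only: two)
  qed
  show ?thesis
  proof
    assume L: ?L
    have pq: "\<forall>i\<in>S. p i * q i \<le> (1/2) / 2"
      using mult_mono[of "p _" "1/2" "q _" "1/2"] p q by fastforce
    have inc: "increasing_family S F" "increasing_family S G"
      using product_measure_cross_intersecting(2)[OF S p q _ _ pq FG] L by auto
    have f: "feasible (1/2) (product_measure S p F) (product_measure S q G)"
      by (rule product_measure_feasible[OF S p q _ _ pq inc FG(3)]) auto
    let ?a = "product_measure S p F" and ?b = "product_measure S q G"
    have ab: "?a + ?b \<le> 1" using f by (simp add: feasible_def)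
    \<comment> \<open>Equality in the AM-GM inequality: the sum is at most 1 and the product is
      \<open>1/4\<close>.\<close>
    have "(?a - ?b)^2 = (?a + ?b)^2 - 4 * (?a * ?b)" by algebra
    also have "\<dots> \<le> 1^2 - 4 * (1/4)"
      using ab f L by (intro diff_mono power_mono) (auto simp: feasible_def)
    finally have eq: "?a = ?b" by simp
    hence "?a^2 = (1/2)^2" using L by (simp add: power2_eq_square)
    hence half: "?a = 1/2" "?b = 1/2" using f eq by (auto simp: feasible_def power2_eq_iff)
    have irr: "A \<in> F \<longleftrightarrow> A - {i} \<in> F" "A \<in> G \<longleftrightarrow> A - {i} \<in> G" if "i \<in> S - I" "A \<subseteq> S" for i A
    proof -
      \<comment> \<open>Outside \<open>I\<close> at least one of the two values lies strictly below
        \<open>1/2\<close>.\<close>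
      have "p i + q i < 1" using that I p q by force
      thus "A \<in> F \<longleftrightarrow> A - {i} \<in> F" "A \<in> G \<longleftrightarrow> A - {i} \<in> G"
        using irrelevant_coordinate[OF S p q inc FG(3)] half that by auto
    qed
    have "A \<in> F \<longleftrightarrow> A \<inter> I \<in> F" "A \<in> G \<longleftrightarrow> A \<inter> I \<in> G" if A: "A \<subseteq> S" for A
    proof -
      have "A - (S - I) = A \<inter> I" using A by auto
      thus "A \<in> F \<longleftrightarrow> A \<inter> I \<in> F" "A \<in> G \<longleftrightarrow> A \<inter> I \<in> G"
        using mem_iff_Diff_irrelevant[of "S - I" S F A] mem_iff_Diff_irrelevant[of "S - I" S G A]
          irr S A by auto
    qed
    hence F: "F = {A. A \<subseteq> S \<and> A \<inter> I \<in> F \<inter> Pow I}" and G: "G = {A. A \<subseteq> S \<and> A \<inter> I \<in> G \<inter> Pow I}"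
      using FG by auto
    have cF: "card (F \<inter> Pow I) = 2 ^ (card I - 1)"
    proof -
      have "real (card (F \<inter> Pow I)) = 2 ^ (card I - 1)"
        using measure[of "F \<inter> Pow I" p] half(1) I' F by simp
      thus ?thesis by (metis of_nat_eq_iff of_nat_numeral of_nat_power)
    qed
    have cG: "card (G \<inter> Pow I) = 2 ^ (card I - 1)"
    proof -
      have "real (card (G \<inter> Pow I)) = 2 ^ (card I - 1)"
        using measure[of "G \<inter> Pow I" q] half(2) I' G by simp
      thus ?thesis by (metis of_nat_eq_iff of_nat_numeral of_nat_power)
    qed
    have "B \<in> F" if "A \<in> F" "A \<subseteq> B" "B \<subseteq> I" for A B
      using inc(1) that subset_trans[OF that(3) I'(1)] unfolding increasing_family_def by meson
    hence incH: "increasing_family I (F \<inter> Pow I)"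
      by (auto simp: increasing_family_def)
    \<comment> \<open>Cross-intersection gives one inclusion; the dual of a family containing half
      of all subsets again has half of them, so equal cardinality gives the other.\<close>
    have "G \<inter> Pow I = dual_family I (F \<inter> Pow I)"
    proof (rule card_subset_eq)
      show "finite (dual_family I (F \<inter> Pow I))"
        using I'(2) by (auto simp: dual_family_def intro: finite_subset[of _ "Pow I"])
      show "G \<inter> Pow I \<subseteq> dual_family I (F \<inter> Pow I)"
        using FG(3) unfolding dual_family_def cross_intersecting_def by blast
      show "card (G \<inter> Pow I) = card (dual_family I (F \<inter> Pow I))"
        unfolding card_dual_family[OF I'(2) incH] cF cG two by simp
    qed
    thus ?R using incH cF F G by (intro exI[of _ "F \<inter> Pow I"]) simp
  next
    assume ?R
    then obtain H where H: "increasing_family I H" "card H = 2 ^ (card I - 1)"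
      "F = {A. A \<subseteq> S \<and> A \<inter> I \<in> H}" "G = {B. B \<subseteq> S \<and> B \<inter> I \<in> dual_family I H}"
      by blast
    have "H \<subseteq> Pow I" using H(1) unfolding increasing_family_def by blast
    hence "product_measure S p F = 1/2" unfolding H(3) using measure[of H p] H(2) I' by simp
    moreover have "card (dual_family I H) = 2 ^ (card I - 1)"
      unfolding card_dual_family[OF I'(2) H(1)] H(2) two by simp
    hence "product_measure S q G = 1/2" unfolding H(4)
      using measure[of "dual_family I H" q] I' by (auto simp: dual_family_def)
    ultimately show ?L using mult_eq_quarter_iff[of "product_measure S p F" "product_measure S q G"]
      by linarith
  qed
qed

section \<open>Bound and equality cases for biased measures on \<open>{1..n}\<close>\<close>

theorem theorem1p3:
  fixes n :: nat and p q :: "nat \<Rightarrow> real" and I :: "nat set" and \<A> \<B> :: "nat set set"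
  assumes "n \<ge> 1"
    and "\<forall>i\<in>{1..n}. 0 < p i \<and> p i \<le> 1 / 2"
    and "\<forall>i\<in>{1..n}. 0 < q i \<and> q i \<le> 1 / 2"
    and "p 1 * q 1 = Max ((\<lambda>i. p i * q i) ` {1..n})"
    and "I = {i \<in> {1..n}. p i * q i = p 1 * q 1}"
    and "\<A> \<subseteq> Pow {1..n}"
    and "\<B> \<subseteq> Pow {1..n}"
    and "cross_intersecting \<A> \<B>"
  shows "biased_measure n p \<A> * biased_measure n q \<B> \<le> p 1 * q 1
    \<and> (p 1 * q 1 < 1 / 4 \<longrightarrow>
         (biased_measure n p \<A> * biased_measure n q \<B> = p 1 * q 1 \<longleftrightarrow>
            (\<exists>j\<in>I. \<A> = star n j \<and> \<B> = star n j)))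
    \<and> (p 1 * q 1 = 1 / 4 \<longrightarrow>
         I = {i \<in> {1..n}. p i = 1 / 2 \<and> q i = 1 / 2} \<and> I \<noteq> {} \<and>
         (biased_measure n p \<A> * biased_measure n q \<B> = p 1 * q 1 \<longleftrightarrow>
            (\<exists>\<H>. increasing_family I \<H> \<and> card \<H> = 2 ^ (card I - 1) \<and>
                 \<A> = {A. A \<subseteq> {1..n} \<and> A \<inter> I \<in> \<H>} \<and>
                 \<B> = {B. B \<subseteq> {1..n} \<and> B \<inter> I \<in> dual_family I \<H>})))"
proof -
  let ?S = "{1..n}"
  have bm: "biased_measure n = product_measure ?S"
    by (auto simp: fun_eq_iff biased_measure_def product_measure_def)
  define m where "m = 2 * (p 1 * q 1)"
  have m2: "p 1 * q 1 = m / 2" by (simp add: m_def)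
  have one: "1 \<in> ?S" using assms(1) by simp
  have pq1: "0 < p 1" "p 1 \<le> 1/2" "0 < q 1" "q 1 \<le> 1/2" using assms(2,3) one by blast+
  hence "p 1 * q 1 \<le> (1/2) * (1/2)" by (intro mult_mono) auto
  hence m: "0 < m" "m \<le> 1/2" using pq1 by (auto simp: m_def)
  have pq: "\<forall>i\<in>?S. p i * q i \<le> m / 2"
    unfolding m2[symmetric] assms(4) by auto
  note general = product_measure_cross_intersecting[OF finite_atLeastAtMost assms(2,3) m pq assms(6-8)]
  have small: "product_measure ?S p \<A> * product_measure ?S q \<B> = m / 2 \<longleftrightarrow>
      (\<exists>j\<in>I. \<A> = star n j \<and> \<B> = star n j)" (is "?L \<longleftrightarrow> ?R") if "m < 1/2"
  proof
    assume ?L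
    hence "increasing_family ?S \<A>" "increasing_family ?S \<B>" using general(2) by auto
    from product_measure_equality[OF finite_atLeastAtMost assms(2,3) m(1) that pq this assms(8)] \<open>?L\<close>
    show ?R unfolding assms(5) star_def m2 by auto
  next
    assume ?R
    \<comment> \<open>The star at \<open>j\<close> has measures \<open>p j\<close> and
      \<open>q j\<close>, whose product is \<open>p 1 * q 1\<close> for
      \<open>j \<in> I\<close>.\<close>
    thus ?L unfolding assms(5) star_def m2 by (auto simp: product_measure_star)
  qed
  have quarter: "I = {i \<in> ?S. p i = 1 / 2 \<and> q i = 1 / 2} \<and> I \<noteq> {}" if "p 1 * q 1 = 1/4"
  proof
    show "I = {i \<in> ?S. p i = 1 / 2 \<and> q i = 1 / 2}"
      using mult_eq_quarter_iff assms(2,3) unfolding assms(5) that by auto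
    show "I \<noteq> {}" using one unfolding assms(5) by blast
  qed
  show ?thesis
    unfolding bm
  proof (intro conjI impI)
    show "product_measure ?S p \<A> * product_measure ?S q \<B> \<le> p 1 * q 1"
      using general(1) unfolding m2 .
    assume "p 1 * q 1 < 1 / 4"
    thus "product_measure ?S p \<A> * product_measure ?S q \<B> = p 1 * q 1 \<longleftrightarrow>
        (\<exists>j\<in>I. \<A> = star n j \<and> \<B> = star n j)"
      using small unfolding m2 by simp
  next
    assume eq: "p 1 * q 1 = 1 / 4"
    show "I = {i \<in> ?S. p i = 1 / 2 \<and> q i = 1 / 2}" "I \<noteq> {}" using quarter[OF eq] by blast+
    thus "product_measure ?S p \<A> * product_measure ?S q \<B> = p 1 * q 1 \<longleftrightarrow>
        (\<exists>\<H>. increasing_family I \<H> \<and> card \<H> = 2 ^ (card I - 1) \<and>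
           \<A> = {A. A \<subseteq> ?S \<and> A \<inter> I \<in> \<H>} \<and>
           \<B> = {B. B \<subseteq> ?S \<and> B \<inter> I \<in> dual_family I \<H>})"
      unfolding eq by (rule product_measure_quarter[OF finite_atLeastAtMost assms(2,3) _ _ assms(6-8)])
  qed
qed

end
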